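(* Let $n,m\in\mathbb{Z}_{>0}$, $A\in\mathbb{R}^{n\times n}$, $B\in\mathbb{R}^{n\times m}$ with $(A,B)$ stabilizable, and let $Q\in\mathbb{R}^{n\times n}$, $R\in\mathbb{R}^{m\times m}$ be symmetric with $Q\succ 0$ and $R\succ 0$. Fix any $\gamma\in[0,1]$. Let $P_\gamma=P_\gamma^\top\succ 0$ be the (unique symmetric positive definite) solution to $$P_\gamma=\gamma A^\top P_\gamma A-\gamma^2A^\top P_\gamma B(R+\gamma B^\top P_\gamma B)^{-1}B^\top P_\gamma A+Q,$$ and let $K_\gamma:=-\gamma(R+\gamma B^\top P_\gamma B)^{-1}B^\top P_\gamma A$. Then $K_\gamma\in\mathcal{K}_1$, i.e., $\rho(A+BK_\gamma)<1$, if and only if there exists a symmetric matrix $X\in\mathbb{R}^{n\times n}$ such that $\gamma P_\gamma+X\succ 0$ and $$K_\gamma^\top RK_\gamma+Q+(\gamma-1)P_\gamma+X-(A+BK_\gamma)^\top X(A+BK_\gamma)\succ 0.$$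
   Context: $\rho(M)$ denotes the spectral radius of a square matrix $M$. For a symmetric matrix, $\succ 0$ means positive definite. $(A,B)$ stabilizable means there is $K\in\mathbb{R}^{m\times n}$ with $\rho(A+BK)<1$. $\mathcal{K}_1:=\{K\in\mathbb{R}^{m\times n}:\rho(A+BK)<1\}$. Under the stated assumptions the discounted Riccati equation in the claim has a unique symmetric positive definite solution $P_\gamma$ (known fact), and $u=K_\gamma x$ is the optimal feedback for the system $x_{k+1}=Ax_k+Bu_k$ with cost $\sum_{k\ge0}\gamma^k(x_k^\top Qx_k+u_k^\top Ru_k)$. *)

theory Defs
  imports
    "Jordan_Normal_Form.Spectral_Radius"
    "Jordan_Normal_Form.Gauss_Jordan_Elimination"
begin

definition symmetric_mat :: "real mat \<Rightarrow> bool" where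
  "symmetric_mat M \<longleftrightarrow> transpose_mat M = M"

definition pos_def :: "real mat \<Rightarrow> bool" where
  "pos_def M \<longleftrightarrow> symmetric_mat M \<and>
     (\<forall>v \<in> carrier_vec (dim_row M). v \<noteq> 0\<^sub>v (dim_row M) \<longrightarrow> v \<bullet> (M *\<^sub>v v) > 0)"

text \<open>Unspecified for singular matrices.\<close>
definition inv_mat :: "real mat \<Rightarrow> real mat" where
  "inv_mat M = the (mat_inverse M)"

text \<open>The eigenvalues of a real matrix are taken over the complex numbers.\<close>
definition real_spectral_radius :: "real mat \<Rightarrow> real" where
  "real_spectral_radius M = spectral_radius (map_mat complex_of_real M)"

definition stabilizing_gains :: "real mat \<Rightarrow> real mat \<Rightarrow> real mat set" where
  "stabilizing_gains A B =
     {K \<in> carrier_mat (dim_col B) (dim_row A). real_spectral_radius (A + B * K) < 1}"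

definition stabilizable :: "real mat \<Rightarrow> real mat \<Rightarrow> bool" where
  "stabilizable A B \<longleftrightarrow>
     (\<exists>K \<in> carrier_mat (dim_col B) (dim_row A). real_spectral_radius (A + B * K) < 1)"

end

theory Submission
  imports Defs
begin

text \<open>With \<open>F = A + B K\<close>, the Riccati equation is the Bellman identity
  \<open>P = \<gamma> F\<^sup>T P F + K\<^sup>T R K + Q\<close>. Hence the second matrix inequality says exactly that
  \<open>Y = \<gamma> P + X\<close> satisfies \<open>Y - F\<^sup>T Y F \<succ> 0\<close>, and the claim becomes
  Lyapunov's criterion: \<open>\<rho>(F) < 1\<close> iff there is such a \<open>Y \<succ> 0\<close>. If \<open>Y\<close> exists, then evaluating
  the two forms on the real and imaginary parts of an eigenvector bounds its eigenvalue. Conversely,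
  some power \<open>F\<^sup>N\<close> is a strict contraction, and the finite sum of \<open>(F\<^sup>k)\<^sup>T F\<^sup>k\<close> over
  \<open>k < N\<close> telescopes to \<open>Y - F\<^sup>T Y F = 1 - (F\<^sup>N)\<^sup>T F\<^sup>N\<close>.\<close>

section \<open>Matrix algebra\<close>

text \<open>The library states these laws with carrier sets, whose dimensions the simplifier cannot
  guess; side conditions on dimensions are solved automatically.\<close>

named_theorems mat_expand

lemma mult_mat_vec_assoc_dim [mat_expand]:
  "dim_col A = dim_row B \<Longrightarrow> dim_col B = dim_vec v \<Longrightarrow>
    (A * B) *\<^sub>v v = A *\<^sub>v (B *\<^sub>v (v :: 'a :: semiring_0 vec))"
  by (rule assoc_mult_mat_vec[of A "dim_row A" "dim_col A" B "dim_col B"]) (auto intro: carrier_vecI)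

lemma add_mult_mat_vec_dim [mat_expand]:
  "dim_row A = dim_row B \<Longrightarrow> dim_col A = dim_col B \<Longrightarrow> dim_col A = dim_vec v \<Longrightarrow>
    (A + B) *\<^sub>v v = A *\<^sub>v v + B *\<^sub>v (v :: 'a :: semiring_0 vec)"
  by (rule add_mult_distrib_mat_vec[of A "dim_row A" "dim_col A" B]) (auto intro: carrier_vecI)

lemma diff_mult_mat_vec_dim [mat_expand]:
  "dim_row A = dim_row B \<Longrightarrow> dim_col A = dim_col B \<Longrightarrow> dim_col A = dim_vec v \<Longrightarrow>
    (A - B) *\<^sub>v v = A *\<^sub>v v - B *\<^sub>v (v :: 'a :: ring vec)"
  by (rule minus_mult_distrib_mat_vec[of A "dim_row A" "dim_col A" B]) (auto intro: carrier_vecI)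

lemma smult_mult_mat_vec_dim [mat_expand]:
  "dim_col A = dim_vec v \<Longrightarrow> (c \<cdot>\<^sub>m A) *\<^sub>v v = c \<cdot>\<^sub>v (A *\<^sub>v (v :: 'a :: comm_semiring_0 vec))"
  by (intro eq_vecI) auto

lemma mult_mat_vec_add_dim [mat_expand]:
  "dim_col A = dim_vec v \<Longrightarrow> dim_vec v = dim_vec w \<Longrightarrow>
    A *\<^sub>v (v + w) = A *\<^sub>v v + A *\<^sub>v (w :: 'a :: semiring_0 vec)"
  by (rule mult_add_distrib_mat_vec[of A "dim_row A" "dim_col A"]) (auto intro: carrier_vecI)

lemma mult_mat_vec_diff_dim [mat_expand]:
  "dim_col A = dim_vec v \<Longrightarrow> dim_vec v = dim_vec w \<Longrightarrow>
    A *\<^sub>v (v - w) = A *\<^sub>v v - A *\<^sub>v (w :: 'a :: ring vec)"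
  by (rule mult_minus_distrib_mat_vec[of A "dim_row A" "dim_col A"]) (auto intro: carrier_vecI)

lemma mult_mat_vec_smult_dim [mat_expand]:
  "dim_col A = dim_vec v \<Longrightarrow> A *\<^sub>v (c \<cdot>\<^sub>v v) = c \<cdot>\<^sub>v (A *\<^sub>v (v :: 'a :: comm_semiring_0 vec))"
  by (intro eq_vecI) auto

lemma scalar_prod_add_right_dim [mat_expand]:
  "dim_vec u = dim_vec v \<Longrightarrow> dim_vec v = dim_vec w \<Longrightarrow>
    u \<bullet> (v + w) = u \<bullet> v + u \<bullet> (w :: 'a :: semiring_0 vec)"
  by (rule scalar_prod_add_distrib[of u "dim_vec u"]) (auto intro: carrier_vecI)

lemma scalar_prod_add_left_dim [mat_expand]:
  "dim_vec u = dim_vec v \<Longrightarrow> dim_vec v = dim_vec w \<Longrightarrow>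
    (u + v) \<bullet> w = u \<bullet> w + v \<bullet> (w :: 'a :: semiring_0 vec)"
  by (rule add_scalar_prod_distrib[of u "dim_vec u"]) (auto intro: carrier_vecI)

lemma scalar_prod_diff_right_dim [mat_expand]:
  "dim_vec u = dim_vec v \<Longrightarrow> dim_vec v = dim_vec w \<Longrightarrow>
    u \<bullet> (v - w) = u \<bullet> v - u \<bullet> (w :: 'a :: ring vec)"
  by (rule scalar_prod_minus_distrib[of u "dim_vec u"]) (auto intro: carrier_vecI)

lemma scalar_prod_diff_left_dim [mat_expand]:
  "dim_vec u = dim_vec v \<Longrightarrow> dim_vec v = dim_vec w \<Longrightarrow>
    (u - v) \<bullet> w = u \<bullet> w - v \<bullet> (w :: 'a :: ring vec)"
  by (rule minus_scalar_prod_distrib[of u "dim_vec u"]) (auto intro: carrier_vecI)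

text \<open>In this orientation the rule moves transposes off the right factor, so simplification
  turns the form of a congruence F^T Y F at \<open>v\<close> into the form of \<open>Y\<close> at F
  v.\<close>

lemma scalar_prod_transpose_dim [mat_expand]:
  assumes "dim_vec x = dim_col A" "dim_vec y = dim_row A"
  shows "x \<bullet> (transpose_mat A *\<^sub>v y) = (A *\<^sub>v x) \<bullet> (y :: 'a :: comm_semiring_0 vec)"
proof -
  have "x \<bullet> (transpose_mat A *\<^sub>v y) = (transpose_mat A *\<^sub>v y) \<bullet> x"
    using assms by (intro comm_scalar_prod[of _ "dim_col A"]) (auto intro: carrier_vecI)
  also have "\<dots> = y \<bullet> (A *\<^sub>v x)"
    using assms by (intro transpose_vec_mult_scalar[of A "dim_row A" "dim_col A"])
      (auto intro: carrier_vecI)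
  also have "\<dots> = (A *\<^sub>v x) \<bullet> y"
    using assms by (intro comm_scalar_prod[of _ "dim_row A"]) (auto intro: carrier_vecI)
  finally show ?thesis .
qed

section \<open>Symmetric and positive definite matrices\<close>

lemma symmetric_mat_add:
  "symmetric_mat M \<Longrightarrow> symmetric_mat N \<Longrightarrow> M \<in> carrier_mat n n \<Longrightarrow> N \<in> carrier_mat n n \<Longrightarrow>
    symmetric_mat (M + N)"
  unfolding symmetric_mat_def by (simp add: transpose_add[of M n n N])

lemma symmetric_mat_diff:
  "symmetric_mat M \<Longrightarrow> symmetric_mat N \<Longrightarrow> M \<in> carrier_mat n n \<Longrightarrow> N \<in> carrier_mat n n \<Longrightarrow>
    symmetric_mat (M - N)"
  unfolding symmetric_mat_def by (simp add: transpose_minus[of M n n N])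

lemma symmetric_mat_smult: "symmetric_mat M \<Longrightarrow> symmetric_mat (c \<cdot>\<^sub>m M)"
proof -
  assume "symmetric_mat M"
  moreover have "transpose_mat (c \<cdot>\<^sub>m M) = c \<cdot>\<^sub>m transpose_mat M" by (intro eq_matI) auto
  ultimately show ?thesis by (simp add: symmetric_mat_def)
qed

lemma symmetric_mat_congruence:
  assumes "symmetric_mat M" "M \<in> carrier_mat n n" "T \<in> carrier_mat n k"
  shows "symmetric_mat (transpose_mat T * M * T)"
proof -
  have "transpose_mat (transpose_mat T * M * T) = transpose_mat T * transpose_mat (transpose_mat T * M)"
    using assms by (intro transpose_mult[of _ k n _ k]) auto
  also have "transpose_mat (transpose_mat T * M) = transpose_mat M * T"
    using assms by (subst transpose_mult[of _ k n _ n]) auto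
  also have "transpose_mat T * (transpose_mat M * T) = transpose_mat T * M * T"
    using assms by (simp add: symmetric_mat_def)
  finally show ?thesis by (simp add: symmetric_mat_def)
qed

lemma pos_defI:
  assumes "M \<in> carrier_mat n n" "symmetric_mat M"
    and "\<And>v. v \<in> carrier_vec n \<Longrightarrow> v \<noteq> 0\<^sub>v n \<Longrightarrow> v \<bullet> (M *\<^sub>v v) > 0"
  shows "pos_def M"
  using assms unfolding pos_def_def by auto

lemma pos_defD:
  assumes "pos_def M" "M \<in> carrier_mat n n"
  shows "v \<in> carrier_vec n \<Longrightarrow> v \<noteq> 0\<^sub>v n \<Longrightarrow> v \<bullet> (M *\<^sub>v v) > 0"
  using assms unfolding pos_def_def by auto

lemma pos_def_nonneg:
  assumes "pos_def M" "M \<in> carrier_mat n n" "v \<in> carrier_vec n"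
  shows "v \<bullet> (M *\<^sub>v v) \<ge> 0"
proof (cases "v = 0\<^sub>v n")
  case True
  then show ?thesis using assms by (simp add: scalar_prod_def)
next
  case False
  then show ?thesis using pos_defD[OF assms] by simp
qed

text \<open>Once symmetry is known, only the quadratic form matters. Two matrix inequalities can
  thus be compared vector by vector, without a matrix identity.\<close>

lemma pos_def_cong_quadratic_form:
  assumes "M \<in> carrier_mat n n" "N \<in> carrier_mat n n" "symmetric_mat M" "symmetric_mat N"
    and "\<And>v. v \<in> carrier_vec n \<Longrightarrow> v \<bullet> (M *\<^sub>v v) = v \<bullet> (N *\<^sub>v v)"
  shows "pos_def M \<longleftrightarrow> pos_def N"
  using assms unfolding pos_def_def by auto

text \<open>A nonzero kernel vector would make the quadratic form vanish. Hence the determinant is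
  nonzero, \<open>mat_inverse\<close> returns a value, and \<open>inv_mat\<close> is a genuine
  inverse.\<close>

lemma inv_mat_pos_def:
  assumes "pos_def M" "M \<in> carrier_mat n n"
  shows "M * inv_mat M = 1\<^sub>m n" "inv_mat M \<in> carrier_mat n n"
proof -
  have "det M \<noteq> 0"
  proof
    assume "det M = 0"
    then obtain v where v: "v \<in> carrier_vec n" "v \<noteq> 0\<^sub>v n" "M *\<^sub>v v = 0\<^sub>v n"
      using det_0_iff_vec_prod_zero_field[OF assms(2)] by auto
    then show False using pos_defD[OF assms, of v] by simp
  qed
  then have "M \<in> Units (ring_mat TYPE(real) n ())"
    by (rule det_non_zero_imp_unit[OF assms(2)])
  then obtain N where N: "mat_inverse M = Some N"
    using mat_inverse(1)[OF assms(2), of "()"] by (cases "mat_inverse M") auto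
  then show "M * inv_mat M = 1\<^sub>m n" "inv_mat M \<in> carrier_mat n n"
    using mat_inverse(2)[OF assms(2) N] by (auto simp: inv_mat_def)
qed

section \<open>Powers of a matrix with spectral radius below one\<close>

lemma pow_smult_mat:
  fixes A :: "'a :: comm_ring_1 mat"
  assumes "A \<in> carrier_mat n n"
  shows "(c \<cdot>\<^sub>m A) ^\<^sub>m k = c ^ k \<cdot>\<^sub>m (A ^\<^sub>m k)"
proof (induction k)
  case 0
  then show ?case by (auto intro!: eq_matI)
next
  case (Suc k)
  have "A ^\<^sub>m k \<in> carrier_mat n n" using assms by simp
  then show ?case using Suc assms by (auto intro!: eq_matI simp: mult_ac)
qed

text \<open>Dividing an eigenvalue of c A by c gives an eigenvalue of A with the same
  eigenvector.\<close>

lemma spectral_radius_smult_le: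
  assumes A: "A \<in> carrier_mat n n" and n: "n > 0" and c: "c \<noteq> 0"
  shows "spectral_radius (c \<cdot>\<^sub>m A) \<le> norm c * spectral_radius A"
proof -
  have cA: "c \<cdot>\<^sub>m A \<in> carrier_mat n n" using A by simp
  obtain e where e: "e \<in> spectrum (c \<cdot>\<^sub>m A)" "spectral_radius (c \<cdot>\<^sub>m A) = norm e"
    using spectral_radius_mem_max(1)[OF cA n] by auto
  then obtain v where v: "v \<in> carrier_vec n" "v \<noteq> 0\<^sub>v n" "(c \<cdot>\<^sub>m A) *\<^sub>v v = e \<cdot>\<^sub>v v"
    using A unfolding spectrum_def eigenvalue_def eigenvector_def by auto
  have "A *\<^sub>v v = inverse c \<cdot>\<^sub>v ((c \<cdot>\<^sub>m A) *\<^sub>v v)"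
    using A v(1) c by (simp add: smult_mult_mat_vec_dim smult_smult_assoc)
  then have "A *\<^sub>v v = (e / c) \<cdot>\<^sub>v v"
    using v by (simp add: smult_smult_assoc field_simps)
  then have "e / c \<in> spectrum A"
    using A v unfolding spectrum_def eigenvalue_def eigenvector_def by auto
  then have "norm (e / c) \<le> spectral_radius A"
    using spectral_radius_mem_max(2)[OF A n] by blast
  then show ?thesis using e c by (simp add: norm_divide field_simps)
qed

text \<open>The Jordan normal form gives a uniform entry bound b for the powers of a matrix with
  spectral radius below one. Applied to A / r with r still above the spectral radius of A, it bounds
  the entries of A^k by r^k b, which tends to 0.\<close>

lemma norm_bound_pow_small:
  assumes A: "A \<in> carrier_mat n n" and n: "n > 0" and sr: "spectral_radius A < 1" and e: "e > 0"
  shows "\<exists>k. norm_bound (A ^\<^sub>m k) e"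
proof -
  \<comment> \<open>The midpoint is positive even when the spectral radius is 0, so A can be divided
    by it.\<close>
  define r where "r = (spectral_radius A + 1) / 2"
  have "spectral_radius A \<ge> 0"
    using spectral_radius_mem_max(1)[OF A n] by auto
  then have r: "0 < r" "r < 1" "spectral_radius A < r"
    using sr by (auto simp: r_def)
  let ?c = "complex_of_real (inverse r)"
  have "spectral_radius (?c \<cdot>\<^sub>m A) \<le> norm ?c * spectral_radius A"
    using spectral_radius_smult_le[OF A n, of ?c] r by simp
  also have "norm ?c = inverse r" using r by (simp add: norm_inverse)
  also have "inverse r * spectral_radius A < 1" using r by (simp add: field_simps)
  finally obtain b where b: "\<And>k. norm_bound ((?c \<cdot>\<^sub>m A) ^\<^sub>m k) b"
    using spectral_radius_jnf_norm_bound_less_1_upper_triangular[of "?c \<cdot>\<^sub>m A" n] A by auto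
  have "(\<lambda>k. r ^ k * b) \<longlonglongrightarrow> 0 * b"
    using r by (intro tendsto_intros LIMSEQ_realpow_zero) auto
  then have "\<forall>\<^sub>F k in sequentially. r ^ k * b < e"
    using e by (intro order_tendstoD(2)) auto
  then obtain k where k: "r ^ k * b < e"
    using eventually_happens'[OF sequentially_bot] by blast
  have "norm_bound (A ^\<^sub>m k) e"
  proof
    fix i j assume ij: "i < dim_row (A ^\<^sub>m k)" "j < dim_col (A ^\<^sub>m k)"
    have "norm (((?c \<cdot>\<^sub>m A) ^\<^sub>m k) $$ (i, j)) \<le> b"
      using b[of k] ij A unfolding norm_bound_def pow_smult_mat[OF A] by auto
    then have "norm ((A ^\<^sub>m k) $$ (i, j)) \<le> r ^ k * b"
      using ij r unfolding pow_smult_mat[OF A]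
      by (simp add: norm_mult norm_divide norm_power norm_inverse field_simps)
    then show "norm ((A ^\<^sub>m k) $$ (i, j)) \<le> e" using k by simp
  qed
  then show ?thesis ..
qed

section \<open>Contraction from small entries\<close>

lemma scalar_prod_self_pos:
  assumes "(v :: real vec) \<in> carrier_vec n" "v \<noteq> 0\<^sub>v n"
  shows "v \<bullet> v > 0"
  using conjugate_square_greater_0_vec[OF assms(1)] assms(2) by simp

text \<open>Expand the square into a double sum and apply 2 |v_j v_k| \<le> v_j^2 + v_k^2 to each
  term. Each v_j^2 then occurs 2n times with weight e^2 / 2, whence the factor n e^2.\<close>

lemma scalar_prod_square_le:
  fixes u v :: "real vec"
  assumes u: "u \<in> carrier_vec n" and v: "v \<in> carrier_vec n"
    and le: "\<And>j. j < n \<Longrightarrow> \<bar>u $ j\<bar> \<le> e"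
  shows "(u \<bullet> v)\<^sup>2 \<le> real n * e\<^sup>2 * (v \<bullet> v)"
proof -
  have summand: "(u $ j * v $ j) * (u $ k * v $ k) \<le> e\<^sup>2 / 2 * ((v $ j)\<^sup>2 + (v $ k)\<^sup>2)"
    if "j < n" "k < n" for j k
  proof -
    have "(u $ j * v $ j) * (u $ k * v $ k) \<le> (\<bar>u $ j\<bar> * \<bar>u $ k\<bar>) * (\<bar>v $ j\<bar> * \<bar>v $ k\<bar>)"
      using abs_ge_self[of "(u $ j * v $ j) * (u $ k * v $ k)"] by (simp add: abs_mult mult_ac)
    also have "\<dots> \<le> (e * e) * (\<bar>v $ j\<bar> * \<bar>v $ k\<bar>)"
      using le[OF that(1)] le[OF that(2)] by (intro mult_right_mono mult_mono) auto
    also have "\<dots> \<le> (e * e) * (((v $ j)\<^sup>2 + (v $ k)\<^sup>2) / 2)"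
      using sum_squares_bound[of "\<bar>v $ j\<bar>" "\<bar>v $ k\<bar>"] by (intro mult_left_mono) auto
    finally show ?thesis by (simp add: power2_eq_square)
  qed
  have "(u \<bullet> v)\<^sup>2 = (\<Sum>j<n. \<Sum>k<n. (u $ j * v $ j) * (u $ k * v $ k))"
    using v by (simp add: scalar_prod_def power2_eq_square sum_product atLeast0LessThan)
  also have "\<dots> \<le> (\<Sum>j<n. \<Sum>k<n. e\<^sup>2 / 2 * ((v $ j)\<^sup>2 + (v $ k)\<^sup>2))"
    by (intro sum_mono summand) auto
  also have "\<dots> = e\<^sup>2 / 2 * (\<Sum>j<n. \<Sum>k<n. (v $ j)\<^sup>2 + (v $ k)\<^sup>2)"
    by (simp only: sum_distrib_left)
  also have "\<dots> = real n * e\<^sup>2 * (\<Sum>j<n. (v $ j)\<^sup>2)"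
    by (simp add: sum.distrib sum_distrib_left[symmetric])
  also have "(\<Sum>j<n. (v $ j)\<^sup>2) = v \<bullet> v"
    using v by (simp add: scalar_prod_def power2_eq_square atLeast0LessThan)
  finally show ?thesis .
qed

text \<open>With entries at most 1 / (2n), each of the n rows contributes at most v.v / (4n), so the
  squared length shrinks at least by the factor 1/4.\<close>

lemma norm_bound_imp_contraction:
  fixes M :: "real mat"
  assumes M: "M \<in> carrier_mat n n" and n: "n > 0" and nb: "norm_bound M (1 / (2 * real n))"
    and v: "v \<in> carrier_vec n" "v \<noteq> 0\<^sub>v n"
  shows "(M *\<^sub>v v) \<bullet> (M *\<^sub>v v) < v \<bullet> v"
proof -
  have "(M *\<^sub>v v) \<bullet> (M *\<^sub>v v) = (\<Sum>i<n. (row M i \<bullet> v)\<^sup>2)"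
    using M by (simp add: scalar_prod_def power2_eq_square atLeast0LessThan)
  also have "\<dots> \<le> (\<Sum>i<n. real n * (1 / (2 * real n))\<^sup>2 * (v \<bullet> v))"
    using M nb v unfolding norm_bound_def
    by (intro sum_mono scalar_prod_square_le) auto
  also have "\<dots> = (v \<bullet> v) / 4"
    using n by (simp add: power2_eq_square field_simps)
  also have "\<dots> < v \<bullet> v"
    using scalar_prod_self_pos[OF v] by simp
  finally show ?thesis .
qed

section \<open>Lyapunov's criterion\<close>

text \<open>The two vectors on the left are the real and imaginary parts of (a + ib)(x + iy). Their
  cross terms have opposite signs and cancel. This replaces the Hermitian form of a complex
  eigenvector by two real forms.\<close>

lemma quadratic_form_rotate:
  fixes Y :: "real mat"
  assumes Y: "Y \<in> carrier_mat n n" and x: "x \<in> carrier_vec n" and y: "y \<in> carrier_vec n"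
  shows "(a \<cdot>\<^sub>v x - b \<cdot>\<^sub>v y) \<bullet> (Y *\<^sub>v (a \<cdot>\<^sub>v x - b \<cdot>\<^sub>v y))
       + (b \<cdot>\<^sub>v x + a \<cdot>\<^sub>v y) \<bullet> (Y *\<^sub>v (b \<cdot>\<^sub>v x + a \<cdot>\<^sub>v y))
       = (a\<^sup>2 + b\<^sup>2) * (x \<bullet> (Y *\<^sub>v x) + y \<bullet> (Y *\<^sub>v y))"
  using assms by (simp add: mat_expand power2_eq_square) (simp add: algebra_simps)

lemma lyapunov_imp_spectral_radius_less_1:
  assumes F: "F \<in> carrier_mat n n" and n: "n > 0"
    and Y: "Y \<in> carrier_mat n n" "pos_def Y"
    and L: "pos_def (Y - transpose_mat F * Y * F)"
  shows "real_spectral_radius F < 1"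
proof -
  let ?F = "map_mat complex_of_real F"
  have F': "?F \<in> carrier_mat n n" using F by simp
  obtain l where l: "l \<in> spectrum ?F" "spectral_radius ?F = norm l"
    using spectral_radius_mem_max(1)[OF F' n] by auto
  then obtain v where v: "v \<in> carrier_vec n" "v \<noteq> 0\<^sub>v n" "?F *\<^sub>v v = l \<cdot>\<^sub>v v"
    using F unfolding spectrum_def eigenvalue_def eigenvector_def by auto
  define x where "x = map_vec Re v"
  define y where "y = map_vec Im v"
  have xy: "x \<in> carrier_vec n" "y \<in> carrier_vec n" using v(1) by (auto simp: x_def y_def)
  have comp: "(\<Sum>j<n. complex_of_real (F $$ (i, j)) * v $ j) = l * v $ i" if "i < n" for i
    using arg_cong[OF v(3), of "\<lambda>w. w $ i"] that F v(1)
    by (simp add: scalar_prod_def atLeast0LessThan)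
  \<comment> \<open>As \<open>F\<close> is real, the eigenvalue equation splits into its real and
    imaginary parts.\<close>
  have Fx: "F *\<^sub>v x = Re l \<cdot>\<^sub>v x - Im l \<cdot>\<^sub>v y"
  proof (rule eq_vecI)
    fix i assume "i < dim_vec (Re l \<cdot>\<^sub>v x - Im l \<cdot>\<^sub>v y)"
    then have i: "i < n" using xy by simp
    show "(F *\<^sub>v x) $ i = (Re l \<cdot>\<^sub>v x - Im l \<cdot>\<^sub>v y) $ i"
      using arg_cong[OF comp[OF i], of Re] i F v(1)
      by (simp add: scalar_prod_def atLeast0LessThan x_def y_def)
  qed (use F xy in auto)
  have Fy: "F *\<^sub>v y = Im l \<cdot>\<^sub>v x + Re l \<cdot>\<^sub>v y"
  proof (rule eq_vecI)
    fix i assume "i < dim_vec (Im l \<cdot>\<^sub>v x + Re l \<cdot>\<^sub>v y)"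
    then have i: "i < n" using xy by simp
    show "(F *\<^sub>v y) $ i = (Im l \<cdot>\<^sub>v x + Re l \<cdot>\<^sub>v y) $ i"
      using arg_cong[OF comp[OF i], of Im] i F v(1)
      by (simp add: scalar_prod_def atLeast0LessThan x_def y_def)
  qed (use F xy in auto)
  let ?q = "\<lambda>w. w \<bullet> (Y *\<^sub>v w)"
  have LM: "Y - transpose_mat F * Y * F \<in> carrier_mat n n"
    using F by (intro minus_carrier_mat) auto
  have form: "w \<bullet> ((Y - transpose_mat F * Y * F) *\<^sub>v w) = ?q w - ?q (F *\<^sub>v w)"
    if "w \<in> carrier_vec n" for w
    using that F Y(1) by (simp add: mat_expand)
  \<comment> \<open>One of \<open>x\<close> and \<open>y\<close> may be zero and then allows only
    the weak decrease. The other one is nonzero and makes the sum strictly smaller.\<close>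
  have decr: "?q (F *\<^sub>v w) \<le> ?q w" if "w \<in> carrier_vec n" for w
    using pos_def_nonneg[OF L LM that] form[OF that] by simp
  have decr': "?q (F *\<^sub>v w) < ?q w" if "w \<in> carrier_vec n" "w \<noteq> 0\<^sub>v n" for w
    using pos_defD[OF L LM that] form[OF that(1)] by simp
  have ne: "x \<noteq> 0\<^sub>v n \<or> y \<noteq> 0\<^sub>v n"
  proof (rule ccontr)
    assume "\<not> ?thesis"
    then have z: "x = 0\<^sub>v n" "y = 0\<^sub>v n" by auto
    have "v = 0\<^sub>v n"
    proof (rule eq_vecI)
      fix i assume "i < dim_vec (0\<^sub>v n :: complex vec)"
      then show "v $ i = 0\<^sub>v n $ i"
        using v(1) arg_cong[OF z(1), of "\<lambda>w. w $ i"] arg_cong[OF z(2), of "\<lambda>w. w $ i"]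
        by (simp add: x_def y_def complex_eq_iff)
    qed (use v(1) in auto)
    then show False using v(2) by simp
  qed
  have "((Re l)\<^sup>2 + (Im l)\<^sup>2) * (?q x + ?q y) = ?q (F *\<^sub>v x) + ?q (F *\<^sub>v y)"
    unfolding Fx Fy using quadratic_form_rotate[OF Y(1) xy] by simp
  also have "\<dots> < ?q x + ?q y"
    using ne decr[OF xy(1)] decr[OF xy(2)] decr'[OF xy(1)] decr'[OF xy(2)] by linarith
  finally have less: "(norm l)\<^sup>2 * (?q x + ?q y) < 1 * (?q x + ?q y)"
    by (simp add: cmod_power2)
  \<comment> \<open>If |l|^2 were at least 1, multiplying by this nonnegative sum would contradict
    \<open>less\<close>.\<close>
  have "?q x + ?q y \<ge> 0"
    using pos_def_nonneg[OF Y(2,1)] xy by (intro add_nonneg_nonneg) auto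
  then have "(norm l)\<^sup>2 < 1" using less
    by (meson linorder_not_le mult_right_mono)
  then have "norm l < 1" by (simp add: power_less_one_iff abs_square_less_1)
  then show ?thesis unfolding real_spectral_radius_def l(2) .
qed

text \<open>This is the sum of (F^j)^T F^j over j < k in Horner form, a truncation of the series
  solving Y - F^T Y F = 1. The recursion lets each property be proved by induction through a single
  congruence.\<close>

fun lyapunov_sum :: "real mat \<Rightarrow> nat \<Rightarrow> real mat" where
  "lyapunov_sum F 0 = 0\<^sub>m (dim_row F) (dim_row F)"
| "lyapunov_sum F (Suc k) = 1\<^sub>m (dim_row F) + transpose_mat F * lyapunov_sum F k * F"

context
  fixes F :: "real mat" and n :: nat
  assumes F: "F \<in> carrier_mat n n"
begin

lemma lyapunov_sum_carrier: "lyapunov_sum F k \<in> carrier_mat n n"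
  using F by (induction k) auto

lemma lyapunov_sum_symmetric: "symmetric_mat (lyapunov_sum F k)"
proof (induction k)
  case 0
  then show ?case using F by (simp add: symmetric_mat_def)
next
  case (Suc k)
  have "symmetric_mat (1\<^sub>m n)" by (simp add: symmetric_mat_def)
  then show ?case
    using F symmetric_mat_congruence[OF Suc lyapunov_sum_carrier F]
    by (auto intro!: symmetric_mat_add[where n = n])
qed

lemma lyapunov_sum_form_Suc:
  assumes "v \<in> carrier_vec n"
  shows "v \<bullet> (lyapunov_sum F (Suc k) *\<^sub>v v)
       = v \<bullet> v + (F *\<^sub>v v) \<bullet> (lyapunov_sum F k *\<^sub>v (F *\<^sub>v v))"
proof -
  have "dim_row (lyapunov_sum F k) = n" "dim_col (lyapunov_sum F k) = n"
    using lyapunov_sum_carrier[of k] by auto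
  then show ?thesis using F assms by (simp add: mat_expand)
qed

lemma lyapunov_sum_form_nonneg:
  "v \<in> carrier_vec n \<Longrightarrow> v \<bullet> (lyapunov_sum F k *\<^sub>v v) \<ge> 0"
proof (induction k arbitrary: v)
  case 0
  then show ?case using F by (simp add: scalar_prod_def)
next
  case (Suc k)
  have "v \<bullet> v \<ge> 0" by (simp add: scalar_prod_def sum_nonneg)
  moreover have "(F *\<^sub>v v) \<bullet> (lyapunov_sum F k *\<^sub>v (F *\<^sub>v v)) \<ge> 0"
    using F Suc.prems by (intro Suc.IH) auto
  ultimately show ?case unfolding lyapunov_sum_form_Suc[OF Suc.prems] by simp
qed

text \<open>Let s_k be the form of the k-th sum. Then s_{k+1}(v) - s_{k+1}(Fv) = v.v - Fv.Fv +
  (s_k(Fv) - s_k(FFv)), and the induction hypothesis at Fv cancels Fv.Fv; hence \<open>v\<close> is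
  arbitrary.\<close>

lemma lyapunov_sum_telescope:
  "v \<in> carrier_vec n \<Longrightarrow>
    v \<bullet> (lyapunov_sum F k *\<^sub>v v) - (F *\<^sub>v v) \<bullet> (lyapunov_sum F k *\<^sub>v (F *\<^sub>v v))
    = v \<bullet> v - (F ^\<^sub>m k *\<^sub>v v) \<bullet> (F ^\<^sub>m k *\<^sub>v v)"
proof (induction k arbitrary: v)
  case 0
  have "F *\<^sub>v v \<in> carrier_vec n" using F 0 by simp
  then have "0\<^sub>m n n *\<^sub>v (F *\<^sub>v v) = 0\<^sub>v n" "0\<^sub>m n n *\<^sub>v v = 0\<^sub>v n"
    using 0 by auto
  then show ?case using F 0 by simp
next
  case (Suc k)
  have Fv: "F *\<^sub>v v \<in> carrier_vec n" using F Suc.prems by simp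
  have "F ^\<^sub>m Suc k *\<^sub>v v = F ^\<^sub>m k *\<^sub>v (F *\<^sub>v v)"
    using F Suc.prems by (simp add: assoc_mult_mat_vec[of _ n n])
  then show ?case
    using Suc.IH[OF Fv] lyapunov_sum_form_Suc[OF Fv] lyapunov_sum_form_Suc[OF Suc.prems]
    by simp
qed

lemma spectral_radius_less_1_imp_lyapunov:
  assumes n: "n > 0" and sr: "real_spectral_radius F < 1"
  shows "\<exists>Y \<in> carrier_mat n n. pos_def Y \<and> pos_def (Y - transpose_mat F * Y * F)"
proof -
  let ?F = "map_mat complex_of_real F"
  have F': "?F \<in> carrier_mat n n" using F by simp
  obtain k where k: "norm_bound (?F ^\<^sub>m k) (1 / (2 * real n))"
    using norm_bound_pow_small[OF F' n, of "1 / (2 * real n)"] sr n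
    unfolding real_spectral_radius_def by auto
  \<comment> \<open>The bound is known for the complex matrix. The embedding of the reals commutes
    with powers and preserves absolute values of entries, so the bound passes to the real
    power.\<close>
  have "?F ^\<^sub>m k = map_mat complex_of_real (F ^\<^sub>m k)"
    by (rule of_real_hom.mat_hom_pow[OF F, symmetric])
  then have nb: "norm_bound (F ^\<^sub>m k) (1 / (2 * real n))"
    using k unfolding norm_bound_def by auto
  have Fk: "F ^\<^sub>m k \<in> carrier_mat n n" using F by simp
  have contr: "(F ^\<^sub>m k *\<^sub>v v) \<bullet> (F ^\<^sub>m k *\<^sub>v v) < v \<bullet> v"
    if "v \<in> carrier_vec n" "v \<noteq> 0\<^sub>v n" for v
    by (rule norm_bound_imp_contraction[OF Fk n nb that])
  define Y where "Y = lyapunov_sum F k"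
  have Y: "Y \<in> carrier_mat n n" "symmetric_mat Y"
    using lyapunov_sum_carrier lyapunov_sum_symmetric by (auto simp: Y_def)
  have tel: "v \<bullet> (Y *\<^sub>v v) - (F *\<^sub>v v) \<bullet> (Y *\<^sub>v (F *\<^sub>v v)) > 0"
    if "v \<in> carrier_vec n" "v \<noteq> 0\<^sub>v n" for v
    using lyapunov_sum_telescope[OF that(1), of k] contr[OF that] by (simp add: Y_def)
  \<comment> \<open>By \<open>tel\<close> the form at \<open>v\<close> strictly exceeds the form at
    F v, which is nonnegative.\<close>
  have "pos_def Y"
  proof (rule pos_defI[OF Y])
    fix v :: "real vec" assume v: "v \<in> carrier_vec n" "v \<noteq> 0\<^sub>v n"
    have "F *\<^sub>v v \<in> carrier_vec n" using F v by simp
    then have "(F *\<^sub>v v) \<bullet> (Y *\<^sub>v (F *\<^sub>v v)) \<ge> 0"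
      unfolding Y_def by (rule lyapunov_sum_form_nonneg)
    then show "v \<bullet> (Y *\<^sub>v v) > 0" using tel[OF v] by simp
  qed
  moreover have "pos_def (Y - transpose_mat F * Y * F)"
  proof (rule pos_defI)
    show "Y - transpose_mat F * Y * F \<in> carrier_mat n n"
      using F by (intro minus_carrier_mat) auto
    show "symmetric_mat (Y - transpose_mat F * Y * F)"
      using F Y symmetric_mat_congruence[OF Y(2,1) F]
      by (intro symmetric_mat_diff[where n = n]) auto
    fix v :: "real vec" assume v: "v \<in> carrier_vec n" "v \<noteq> 0\<^sub>v n"
    show "v \<bullet> ((Y - transpose_mat F * Y * F) *\<^sub>v v) > 0"
      using tel[OF v] F Y(1) v(1) by (simp add: mat_expand)
  qed
  ultimately show ?thesis using Y(1) by blast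
qed

end

section \<open>The discounted Riccati equation\<close>

text \<open>The form of \<open>R\<close> is strictly positive, while the second term is nonnegative
  and may vanish, as when B w = 0. Together with \<open>inv_mat_pos_def\<close> this justifies the
  inverse in the Riccati equation.\<close>

lemma pos_def_add_congruence:
  assumes R: "R \<in> carrier_mat m m" "pos_def R" and \<gamma>: "0 \<le> \<gamma>"
    and P: "P \<in> carrier_mat n n" "pos_def P" and B: "B \<in> carrier_mat n m"
  shows "pos_def (R + \<gamma> \<cdot>\<^sub>m (transpose_mat B * P * B))"
proof (rule pos_defI)
  show "R + \<gamma> \<cdot>\<^sub>m (transpose_mat B * P * B) \<in> carrier_mat m m"
    using R(1) P(1) B by simp
  have sym: "symmetric_mat P" "symmetric_mat R" using P R by (auto simp: pos_def_def)
  show "symmetric_mat (R + \<gamma> \<cdot>\<^sub>m (transpose_mat B * P * B))"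
    using R(1) P(1) B sym(2) symmetric_mat_congruence[OF sym(1) P(1) B]
    by (intro symmetric_mat_add[where n = m] symmetric_mat_smult) auto
  fix w :: "real vec" assume w: "w \<in> carrier_vec m" "w \<noteq> 0\<^sub>v m"
  have "B *\<^sub>v w \<in> carrier_vec n" using B w by simp
  from pos_def_nonneg[OF P(2,1) this] pos_defD[OF R(2,1) w] \<gamma>
  have "w \<bullet> (R *\<^sub>v w) + \<gamma> * ((B *\<^sub>v w) \<bullet> (P *\<^sub>v (B *\<^sub>v w))) > 0"
    by (simp add: add_pos_nonneg)
  then show "w \<bullet> ((R + \<gamma> \<cdot>\<^sub>m (transpose_mat B * P * B)) *\<^sub>v w) > 0"
    using R(1) P(1) B w by (simp add: mat_expand)
qed

text \<open>The input k = K v solves the normal equation S k = -\<gamma> B^T P A v with S = R +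
  \<gamma> B^T P B, the stationarity condition of the one-step minimisation. Pairing it with k
  trades the terms quadratic in k for one cross term; the Riccati equation supplies the
  rest.\<close>

lemma riccati_bellman:
  fixes A B Q R P K :: "real mat" and \<gamma> :: real
  assumes A: "A \<in> carrier_mat n n" and B: "B \<in> carrier_mat n m"
    and Q: "Q \<in> carrier_mat n n"
    and R: "R \<in> carrier_mat m m" "pos_def R"
    and \<gamma>: "0 \<le> \<gamma>"
    and P: "P \<in> carrier_mat n n" "pos_def P"
    and ric: "P = \<gamma> \<cdot>\<^sub>m (transpose_mat A * P * A)
           - \<gamma>\<^sup>2 \<cdot>\<^sub>m (transpose_mat A * P * B
                * inv_mat (R + \<gamma> \<cdot>\<^sub>m (transpose_mat B * P * B))
                * transpose_mat B * P * A)
           + Q"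
    and K: "K = (- \<gamma>) \<cdot>\<^sub>m (inv_mat (R + \<gamma> \<cdot>\<^sub>m (transpose_mat B * P * B))
                * transpose_mat B * P * A)"
    and v: "v \<in> carrier_vec n"
  shows "v \<bullet> (P *\<^sub>v v) = \<gamma> * (((A + B * K) *\<^sub>v v) \<bullet> (P *\<^sub>v ((A + B * K) *\<^sub>v v)))
       + (K *\<^sub>v v) \<bullet> (R *\<^sub>v (K *\<^sub>v v)) + v \<bullet> (Q *\<^sub>v v)"
proof -
  define S where "S = R + \<gamma> \<cdot>\<^sub>m (transpose_mat B * P * B)"
  define W where "W = inv_mat S"
  have S: "S \<in> carrier_mat m m" using R(1) P(1) B by (simp add: S_def)
  have "pos_def S" unfolding S_def by (rule pos_def_add_congruence[OF R \<gamma> P B])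
  note W = inv_mat_pos_def[OF this S, folded W_def]
  have K': "K = (- \<gamma>) \<cdot>\<^sub>m (W * transpose_mat B * P * A)"
    using K by (simp add: W_def S_def)
  have Kc: "K \<in> carrier_mat m n" unfolding K' using carrier_matD[OF W(2)] A by (intro carrier_matI) simp_all
  define a where "a = A *\<^sub>v v"
  define k where "k = K *\<^sub>v v"
  define d where "d = transpose_mat B *\<^sub>v (P *\<^sub>v a)"
  have a: "a \<in> carrier_vec n" and k: "k \<in> carrier_vec m" and d: "d \<in> carrier_vec m"
    using A B v Kc P(1) by (auto simp: a_def k_def d_def)
  have kW: "k = (- \<gamma>) \<cdot>\<^sub>v (W *\<^sub>v d)"
    unfolding k_def K' d_def a_def using W(2) A B P(1) v by (simp add: mat_expand)
  have "S *\<^sub>v (W *\<^sub>v d) = d"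
    using assoc_mult_mat_vec[OF S W(2) d] W(1) d by simp
  then have "S *\<^sub>v k = (- \<gamma>) \<cdot>\<^sub>v d"
    unfolding kW using S W(2) d by (simp add: mult_mat_vec_smult_dim)
  then have "k \<bullet> (S *\<^sub>v k) = - \<gamma> * (k \<bullet> d)" using k d by simp
  moreover have "k \<bullet> d = (B *\<^sub>v k) \<bullet> (P *\<^sub>v a)"
    unfolding d_def using k B P(1) a by (simp add: mat_expand)
  moreover have "k \<bullet> (S *\<^sub>v k) = k \<bullet> (R *\<^sub>v k) + \<gamma> * ((B *\<^sub>v k) \<bullet> (P *\<^sub>v (B *\<^sub>v k)))"
    unfolding S_def using R(1) P(1) B k by (simp add: mat_expand)
  ultimately have gain: "k \<bullet> (R *\<^sub>v k) + \<gamma> * ((B *\<^sub>v k) \<bullet> (P *\<^sub>v (B *\<^sub>v k)))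
      = - \<gamma> * ((B *\<^sub>v k) \<bullet> (P *\<^sub>v a))" by simp
  have "P = \<gamma> \<cdot>\<^sub>m (transpose_mat A * P * A)
      - \<gamma>\<^sup>2 \<cdot>\<^sub>m (transpose_mat A * P * B * W * transpose_mat B * P * A) + Q" (is "P = ?rhs")
    using ric by (simp add: W_def S_def)
  then have "v \<bullet> (P *\<^sub>v v) = v \<bullet> (?rhs *\<^sub>v v)" by simp
  also have "\<dots> = \<gamma> * (a \<bullet> (P *\<^sub>v a)) - \<gamma>\<^sup>2 * (a \<bullet> (P *\<^sub>v (B *\<^sub>v (W *\<^sub>v d)))) + v \<bullet> (Q *\<^sub>v v)"
    unfolding d_def a_def using W(2) A B P(1) Q v by (simp add: mat_expand)
  \<comment> \<open>One factor \<gamma> is absorbed by k = -\<gamma> W d. Nothing is divided by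
    \<gamma>, so \<gamma> = 0 is covered.\<close>
  also have "\<gamma>\<^sup>2 * (a \<bullet> (P *\<^sub>v (B *\<^sub>v (W *\<^sub>v d)))) = - \<gamma> * (a \<bullet> (P *\<^sub>v (B *\<^sub>v k)))"
    unfolding kW using W(2) B P(1) a d by (simp add: mat_expand power2_eq_square)
  finally have val: "v \<bullet> (P *\<^sub>v v) = \<gamma> * (a \<bullet> (P *\<^sub>v a)) + \<gamma> * (a \<bullet> (P *\<^sub>v (B *\<^sub>v k)))
      + v \<bullet> (Q *\<^sub>v v)" by simp
  have "(A + B * K) *\<^sub>v v = a + B *\<^sub>v k"
    unfolding a_def k_def using A B Kc v by (simp add: mat_expand)
  moreover have "(a + B *\<^sub>v k) \<bullet> (P *\<^sub>v (a + B *\<^sub>v k)) = a \<bullet> (P *\<^sub>v a) + a \<bullet> (P *\<^sub>v (B *\<^sub>v k))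
      + (B *\<^sub>v k) \<bullet> (P *\<^sub>v a) + (B *\<^sub>v k) \<bullet> (P *\<^sub>v (B *\<^sub>v k))"
    using a B k P(1) by (simp add: mat_expand)
  \<comment> \<open>By \<open>gain\<close> the terms quadratic in \<open>k\<close> cancel the cross
    term (B k).(P a); what remains is \<open>val\<close>.\<close>
  ultimately show ?thesis
    using val gain unfolding k_def[symmetric] by (simp add: algebra_simps)
qed

section \<open>The equivalence, through the substitution Y = \<gamma> P + X\<close>

theorem theorem2:
  fixes n m :: nat and A B Q R P K :: "real mat" and \<gamma> :: real
  assumes "n > 0" and "m > 0"
    and "A \<in> carrier_mat n n" and "B \<in> carrier_mat n m"
    and "stabilizable A B"
    and "Q \<in> carrier_mat n n" and "symmetric_mat Q" and "pos_def Q"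
    and "R \<in> carrier_mat m m" and "symmetric_mat R" and "pos_def R"
    and "0 \<le> \<gamma>" and "\<gamma> \<le> 1"
    and "P \<in> carrier_mat n n" and "symmetric_mat P" and "pos_def P"
    and "P = \<gamma> \<cdot>\<^sub>m (transpose_mat A * P * A)
           - \<gamma>\<^sup>2 \<cdot>\<^sub>m (transpose_mat A * P * B
                * inv_mat (R + \<gamma> \<cdot>\<^sub>m (transpose_mat B * P * B))
                * transpose_mat B * P * A)
           + Q"
    and "K = (- \<gamma>) \<cdot>\<^sub>m (inv_mat (R + \<gamma> \<cdot>\<^sub>m (transpose_mat B * P * B))
                * transpose_mat B * P * A)"
  shows "K \<in> stabilizing_gains A B \<longleftrightarrow>
    (\<exists>X \<in> carrier_mat n n. symmetric_mat X \<and>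
       pos_def (\<gamma> \<cdot>\<^sub>m P + X) \<and>
       pos_def (transpose_mat K * R * K + Q + (\<gamma> - 1) \<cdot>\<^sub>m P + X
                 - transpose_mat (A + B * K) * X * (A + B * K)))"
proof -
  note A = assms(3) and B = assms(4) and Q = assms(6,7) and R = assms(9,10) and P = assms(14,15)
  define F where "F = A + B * K"
  \<comment> \<open>The dimensions of \<open>K\<close> come from its formula, but only after the
    inverse is known to exist, since \<open>inv_mat\<close> is unspecified on singular
    matrices.\<close>
  have "inv_mat (R + \<gamma> \<cdot>\<^sub>m (transpose_mat B * P * B)) \<in> carrier_mat m m"
    using pos_def_add_congruence[OF assms(9,11,12,14,16) B] R(1) B
    by (intro inv_mat_pos_def(2)) auto
  then have K: "K \<in> carrier_mat m n"
    unfolding assms(18) using A by (intro carrier_matI) simp_all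
  have F: "F \<in> carrier_mat n n" using A B K by (simp add: F_def)
  \<comment> \<open>The forms of the two matrices differ by Kv.(R Kv) + v.(Q v) - v.(P v) + \<gamma>
    Fv.(P Fv), which is zero by \<open>riccati_bellman\<close>.\<close>
  have lmi: "pos_def (transpose_mat K * R * K + Q + (\<gamma> - 1) \<cdot>\<^sub>m P + X - transpose_mat F * X * F)
      \<longleftrightarrow> pos_def (\<gamma> \<cdot>\<^sub>m P + X - transpose_mat F * (\<gamma> \<cdot>\<^sub>m P + X) * F)"
    if X: "X \<in> carrier_mat n n" "symmetric_mat X" for X
  proof (rule pos_def_cong_quadratic_form[where n = n])
    have Y: "\<gamma> \<cdot>\<^sub>m P + X \<in> carrier_mat n n" "symmetric_mat (\<gamma> \<cdot>\<^sub>m P + X)"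
      using P X by (auto intro!: symmetric_mat_add[where n = n] symmetric_mat_smult)
    show "transpose_mat K * R * K + Q + (\<gamma> - 1) \<cdot>\<^sub>m P + X - transpose_mat F * X * F \<in> carrier_mat n n"
      "\<gamma> \<cdot>\<^sub>m P + X - transpose_mat F * (\<gamma> \<cdot>\<^sub>m P + X) * F \<in> carrier_mat n n"
      using F X P by (auto intro!: minus_carrier_mat)
    show "symmetric_mat (transpose_mat K * R * K + Q + (\<gamma> - 1) \<cdot>\<^sub>m P + X - transpose_mat F * X * F)"
      using symmetric_mat_congruence[OF R(2,1) K] symmetric_mat_congruence[OF X(2,1) F] P Q R X F K
      by (intro symmetric_mat_diff[where n = n] symmetric_mat_add[where n = n] symmetric_mat_smult)
        auto
    show "symmetric_mat (\<gamma> \<cdot>\<^sub>m P + X - transpose_mat F * (\<gamma> \<cdot>\<^sub>m P + X) * F)"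
      using symmetric_mat_congruence[OF Y(2,1) F] Y F
      by (intro symmetric_mat_diff[where n = n]) auto
    fix v :: "real vec" assume v: "v \<in> carrier_vec n"
    show "v \<bullet> ((transpose_mat K * R * K + Q + (\<gamma> - 1) \<cdot>\<^sub>m P + X - transpose_mat F * X * F) *\<^sub>v v)
        = v \<bullet> ((\<gamma> \<cdot>\<^sub>m P + X - transpose_mat F * (\<gamma> \<cdot>\<^sub>m P + X) * F) *\<^sub>v v)"
      using riccati_bellman[OF A B Q(1) R(1) assms(11,12) P(1) assms(16-18) v, folded F_def]
        P(1) Q(1) R(1) X(1) F K v
      by (simp add: mat_expand) (simp add: algebra_simps)
  qed
  show ?thesis
  proof
    assume "K \<in> stabilizing_gains A B"
    then have "real_spectral_radius F < 1" by (simp add: stabilizing_gains_def F_def)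
    then obtain Y where Y: "Y \<in> carrier_mat n n" "pos_def Y"
        "pos_def (Y - transpose_mat F * Y * F)"
      using spectral_radius_less_1_imp_lyapunov[OF F assms(1)] by blast
    let ?X = "Y - \<gamma> \<cdot>\<^sub>m P"
    have X: "?X \<in> carrier_mat n n" "symmetric_mat ?X"
      using Y P by (auto simp: pos_def_def intro!: symmetric_mat_diff[where n = n]
          symmetric_mat_smult minus_carrier_mat)
    have "\<gamma> \<cdot>\<^sub>m P + ?X = Y" using Y(1) P(1) by (intro eq_matI) auto
    then show "\<exists>X \<in> carrier_mat n n. symmetric_mat X \<and> pos_def (\<gamma> \<cdot>\<^sub>m P + X) \<and>
       pos_def (transpose_mat K * R * K + Q + (\<gamma> - 1) \<cdot>\<^sub>m P + X
                 - transpose_mat (A + B * K) * X * (A + B * K))"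
      using Y X lmi[OF X] unfolding F_def[symmetric] by (intro bexI[of _ ?X]) simp_all
  next
    assume "\<exists>X \<in> carrier_mat n n. symmetric_mat X \<and> pos_def (\<gamma> \<cdot>\<^sub>m P + X) \<and>
       pos_def (transpose_mat K * R * K + Q + (\<gamma> - 1) \<cdot>\<^sub>m P + X
                 - transpose_mat (A + B * K) * X * (A + B * K))"
    then obtain X where X: "X \<in> carrier_mat n n" "symmetric_mat X" "pos_def (\<gamma> \<cdot>\<^sub>m P + X)"
      "pos_def (\<gamma> \<cdot>\<^sub>m P + X - transpose_mat F * (\<gamma> \<cdot>\<^sub>m P + X) * F)"
      using lmi unfolding F_def[symmetric] by blast
    have "\<gamma> \<cdot>\<^sub>m P + X \<in> carrier_mat n n" using P X by simp
    then have "real_spectral_radius F < 1"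
      using lyapunov_imp_spectral_radius_less_1[OF F assms(1) _ X(3,4)] by blast
    then show "K \<in> stabilizing_gains A B"
      using A B K by (simp add: stabilizing_gains_def F_def)
  qed
qed

end
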